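(* Let $m\in\mathbb{N}$, let $p_k\in\mathbb{N}$ and $M_k\ge 0$ for $k=1,2,\ldots,m-1$. Let $F(z)=\sum_{k=0}^{m-1}\overline{z}^k f_k(z)$ be a poly-analytic function of order $m$ in the unit disk $\mathbb{D}$, where all the $f_k$ are holomorphic in $\mathbb{D}$, satisfying $F_z(0)=1$, $f_0(0)=0$, and $f_k(0)=f_k'(0)=\cdots=f_k^{(p_k-1)}(0)=0$ for $k\in\{1,2,\ldots,m-1\}$. Suppose that $|f_0'(z)|<M_0$ for some $M_0>0$ and all $z\in\mathbb{D}$, and $|f_k^{(p_k)}(z)|\le M_k$ for all $k\in\{1,2,\ldots,m-1\}$ and all $z\in\mathbb{D}$. Then $M_0>1$, $F$ is univalent in $\mathbb{D}_{r_0}$, and $F(\mathbb{D}_{r_0})$ contains the schlicht disk $\mathbb{D}_{r_1}$, where $r_0$ is the unique root in $(0,1)$ of the equation $$M_0\frac{1-M_0 r}{M_0-r}-\sum_{k=1}^{m-1}(k+p_k)M_k\frac{r^{k+p_k-1}}{p_k!}=0$$ and $$r_1=M_0^2 r_0+(M_0^3-M_0)\log\left(1-\frac{r_0}{M_0}\right)-\sum_{k=1}^{m-1}M_k\frac{r_0^{p_k+k}}{p_k!}.$$ The result is sharp, with an extremal function given by $$G_1(z)=M_0^2 z+(M_0^3-M_0)\log\left(1-\frac{z}{M_0}\right)-\sum_{k=1}^{m-1}M_k\,\overline{z}^k\frac{z^{p_k}}{p_k!};$$ that is (for $M_0>1$), $G_1$ satisfies all the hypotheses above, $G_1$ is not univalent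 in $\mathbb{D}_r$ for any $r\in(r_0,1]$, and $G_1(\mathbb{D}_{r_0})$ contains no disk $\mathbb{D}_\rho$ with $\rho>r_1$.
   Context: $\mathbb{D}_r=\{z\in\mathbb{C}:|z|<r\}$ and $\mathbb{D}=\mathbb{D}_1$; $\mathbb{N}=\{1,2,\ldots\}$. A poly-analytic function of order $m$ in a domain $\Omega$ is a function of the form $F(z)=\sum_{k=0}^{m-1}\overline{z}^k f_k(z)$ with all $f_k$ analytic in $\Omega$. $F_z$ and $F_{\overline z}$ denote the Wirtinger derivatives $\frac12(F_x-iF_y)$ and $\frac12(F_x+iF_y)$. Univalent means injective. A schlicht disk in the image of $F$ is a disk that is the univalent image under $F$ of some region in the domain. $\log$ is the principal branch. Empty sums are $0$. *)

theory Defs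
  imports "HOL-Complex_Analysis.Complex_Analysis"
begin

text \<open>
  The components \<open>f\<close> are an explicit argument because statements about poly-analytic
  functions usually impose conditions on them.
\<close>

definition polyanalytic_with ::
    "nat \<Rightarrow> (nat \<Rightarrow> complex \<Rightarrow> complex) \<Rightarrow> (complex \<Rightarrow> complex) \<Rightarrow> complex set \<Rightarrow> bool" where
  "polyanalytic_with m f F \<Omega> \<longleftrightarrow>
     (\<forall>k<m. f k holomorphic_on \<Omega>) \<and> (\<forall>z\<in>\<Omega>. F z = (\<Sum>k<m. cnj z ^ k * f k z))"

definition wirtinger_z :: "(complex \<Rightarrow> complex) \<Rightarrow> complex \<Rightarrow> complex" where
  "wirtinger_z F z =
     (vector_derivative (\<lambda>x::real. F (z + of_real x)) (at 0)
      - \<i> * vector_derivative (\<lambda>y::real. F (z + \<i> * of_real y)) (at 0)) / 2"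

text \<open>
  The disk with centre \<open>c\<close> and radius \<open>\<rho>\<close> is a schlicht disk in \<open>F ` S\<close>. A disk is
  non-degenerate, so the radius has to be positive.
\<close>

definition schlicht_disk :: "(complex \<Rightarrow> complex) \<Rightarrow> complex set \<Rightarrow> complex \<Rightarrow> real \<Rightarrow> bool" where
  "schlicht_disk F S c \<rho> \<longleftrightarrow>
     0 < \<rho> \<and> (\<exists>U\<subseteq>S. open U \<and> connected U \<and> inj_on F U \<and> F ` U = ball c \<rho>)"

text \<open>
  In what follows \<open>M 0\<close> bounds the derivative of \<open>f 0\<close>, whereas for \<open>1 \<le> k < m\<close> the number \<open>M k\<close>
  bounds the derivative of order \<open>p k\<close> of \<open>f k\<close>; the value \<open>p 0\<close> is irrelevant.
\<close>

definition landau_hyps ::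
    "nat \<Rightarrow> (nat \<Rightarrow> nat) \<Rightarrow> (nat \<Rightarrow> real) \<Rightarrow> (nat \<Rightarrow> complex \<Rightarrow> complex) \<Rightarrow> (complex \<Rightarrow> complex) \<Rightarrow> bool"
  where
  "landau_hyps m p M f F \<longleftrightarrow>
     polyanalytic_with m f F (ball 0 1) \<and>
     wirtinger_z F 0 = 1 \<and>
     f 0 0 = 0 \<and>
     (\<forall>k\<in>{1..<m}. \<forall>j<p k. (deriv ^^ j) (f k) 0 = 0) \<and>
     (\<forall>z\<in>ball 0 1. norm (deriv (f 0) z) < M 0) \<and>
     (\<forall>k\<in>{1..<m}. \<forall>z\<in>ball 0 1. norm ((deriv ^^ p k) (f k) z) \<le> M k)"

definition is_landau_root :: "nat \<Rightarrow> (nat \<Rightarrow> nat) \<Rightarrow> (nat \<Rightarrow> real) \<Rightarrow> real \<Rightarrow> bool" where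
  "is_landau_root m p M r \<longleftrightarrow>
     r \<in> {0<..<1} \<and>
     M 0 * ((1 - M 0 * r) / (M 0 - r))
       - (\<Sum>k\<in>{1..<m}. real (k + p k) * M k * (r ^ (k + p k - 1) / fact (p k))) = 0"

definition schlicht_radius :: "nat \<Rightarrow> (nat \<Rightarrow> nat) \<Rightarrow> (nat \<Rightarrow> real) \<Rightarrow> real \<Rightarrow> real" where
  "schlicht_radius m p M r =
     (M 0)\<^sup>2 * r + ((M 0) ^ 3 - M 0) * ln (1 - r / M 0)
       - (\<Sum>k\<in>{1..<m}. M k * (r ^ (p k + k) / fact (p k)))"

definition extremal_G :: "nat \<Rightarrow> (nat \<Rightarrow> nat) \<Rightarrow> (nat \<Rightarrow> real) \<Rightarrow> complex \<Rightarrow> complex" where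
  "extremal_G m p M z =
     of_real ((M 0)\<^sup>2) * z + of_real ((M 0) ^ 3 - M 0) * Ln (1 - z / of_real (M 0))
       - (\<Sum>k\<in>{1..<m}. of_real (M k) * cnj z ^ k * (z ^ p k / fact (p k)))"

end

theory Submission
  imports Defs
begin

text \<open>
  Write \<open>L(r)\<close> for the left-hand side of the equation for \<open>r\<^sub>0\<close>; it is the derivative of the
  function \<open>R\<close> with \<open>r\<^sub>1 = R(r\<^sub>0)\<close>. The Schwarz lemma, applied to \<open>f\<^sub>0'/M\<^sub>0\<close> followed by a disk
  automorphism, bounds the real part of \<open>f\<^sub>0'\<close> from below, and integrating the bounds on
  \<open>f\<^sub>k\<close> from the origin controls the other terms. Together they show that the derivative \<open>D\<close> of
  \<open>F\<close> at \<open>z\<close> in the direction \<open>w\<close> satisfies \<open>Re (cnj w * D) \<ge> L(|z|) |w|\<^sup>2\<close>. Hence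
  \<open>Re (cnj w * F)\<close> increases strictly along segments of direction \<open>w\<close> in \<open>|z| \<le> r\<^sub>0\<close>, which gives
  injectivity, and comparing \<open>F\<close> with \<open>R\<close> along radii gives \<open>|F| \<ge> r\<^sub>1\<close> on the circle of radius
  \<open>r\<^sub>0\<close>, which gives the covered disk. On the real axis the extremal function is \<open>R\<close>, which
  turns around at \<open>r\<^sub>0\<close>.
\<close>

section \<open>Pointwise estimates for the holomorphic components\<close>

text \<open>Induction on \<open>n\<close>: the hypotheses for \<open>g\<close> at
  \<open>Suc n\<close> become those for \<open>deriv g\<close> at \<open>n\<close>, and passing from
  \<open>deriv g\<close> back to \<open>g\<close> along the segment from 0 to \<open>z\<close> gains
  one power of |z| and one factor of the factorial.\<close>

lemma norm_le_of_higher_deriv_le: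
  fixes g :: "complex \<Rightarrow> complex"
  assumes "g holomorphic_on ball 0 R"
    and "\<And>j. j < n \<Longrightarrow> (deriv ^^ j) g 0 = 0"
    and "\<And>z. z \<in> ball 0 R \<Longrightarrow> norm ((deriv ^^ n) g z) \<le> B"
    and "z \<in> ball 0 R"
  shows "norm (g z) \<le> B * norm z ^ n / fact n"
  using assms
proof (induction n arbitrary: g z)
  case 0
  then show ?case by simp
next
  case (Suc n)
  have hol: "deriv g holomorphic_on ball 0 R"
    using Suc.prems(1) by (intro holomorphic_deriv) auto
  have bound: "norm (deriv g w) \<le> B * norm w ^ n / fact n" if "w \<in> ball 0 R" for w
  proof (rule Suc.IH[OF hol _ _ that])
    show "(deriv ^^ j) (deriv g) 0 = 0" if "j < n" for j
      using Suc.prems(2)[of "Suc j"] that by (simp add: funpow_Suc_right del: funpow.simps)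
    show "norm ((deriv ^^ n) (deriv g) u) \<le> B" if "u \<in> ball 0 R" for u
      using Suc.prems(3)[OF that] by (simp add: funpow_Suc_right del: funpow.simps)
  qed
  have seg: "of_real t * z \<in> ball 0 R" if "0 \<le> t" "t \<le> 1" for t :: real
  proof -
    have "\<bar>t\<bar> * norm z \<le> 1 * norm z" using that by (intro mult_right_mono) auto
    then show ?thesis using Suc.prems(4) by (simp add: norm_mult)
  qed
  have der: "((\<lambda>t. g (of_real t * z)) has_vector_derivative z * deriv g (of_real t * z)) (at t)"
    if "0 \<le> t" "t \<le> 1" for t :: real
  proof -
    have "(g has_field_derivative deriv g (of_real t * z)) (at (of_real t * z))"
      using Suc.prems(1) seg[OF that] by (intro holomorphic_derivI) auto
    moreover have "((\<lambda>t. of_real t * z) has_vector_derivative z) (at t)"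
      by (auto intro!: derivative_eq_intros)
    ultimately show ?thesis
      using field_vector_diff_chain_at[of "\<lambda>t. of_real t * z" z t g] by (simp add: o_def)
  qed
  \<comment> \<open>Integration is replaced by the mean value inequality: on [0,1] the speed of t ->
    g(tz) is dominated by the derivative of the real majorant B |z|^(n+1) t^(n+1)/(n+1)!. The
    endpoints are left unsimplified to match the rule.\<close>
  have "norm (g (of_real 1 * z) - g (of_real 0 * z))
      \<le> B * norm z ^ Suc n * 1 ^ Suc n / fact (Suc n) - B * norm z ^ Suc n * 0 ^ Suc n / fact (Suc n)"
  proof (rule differentiable_bound_general[where f' = "\<lambda>t. z * deriv g (of_real t * z)"
        and \<phi>' = "\<lambda>t. B * norm z ^ Suc n * t ^ n / fact n"])
    show "continuous_on {0..1} (\<lambda>t. g (of_real t * z))"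
      using der by (intro continuous_at_imp_continuous_on ballI)
        (auto intro: has_vector_derivative_continuous)
    show "continuous_on {0..1} (\<lambda>t. B * norm z ^ Suc n * t ^ Suc n / fact (Suc n))"
      by (intro continuous_intros) auto
    fix t :: real
    assume t: "0 < t" "t < 1"
    show "((\<lambda>t. g (of_real t * z)) has_vector_derivative z * deriv g (of_real t * z)) (at t)"
      using der t by simp
    have "((\<lambda>t. B * norm z ^ Suc n * t ^ Suc n / fact (Suc n)) has_real_derivative
        B * norm z ^ Suc n * (of_nat (Suc n) * t ^ n) / fact (Suc n)) (at t)"
      by (auto intro!: derivative_eq_intros simp del: of_nat_Suc power_Suc fact_Suc)
    also have "B * norm z ^ Suc n * (of_nat (Suc n) * t ^ n) / fact (Suc n)
        = B * norm z ^ Suc n * t ^ n / fact n"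
      by (simp add: field_simps del: of_nat_Suc)
    finally show "((\<lambda>t. B * norm z ^ Suc n * t ^ Suc n / fact (Suc n)) has_vector_derivative
        B * norm z ^ Suc n * t ^ n / fact n) (at t)"
      by (simp only: has_real_derivative_iff_has_vector_derivative)
    have "norm (z * deriv g (of_real t * z)) \<le> norm z * (B * norm (of_real t * z) ^ n / fact n)"
      using bound[OF seg[of t]] t by (simp only: norm_mult mult_left_mono norm_ge_zero less_imp_le)
    then show "norm (z * deriv g (of_real t * z)) \<le> B * norm z ^ Suc n * t ^ n / fact n"
      using t by (simp add: norm_mult power_mult_distrib mult_ac)
  qed auto
  then show ?case using Suc.prems(2)[of 0] by simp
qed

text \<open>The map \<open>\<phi>\<close> is g/K followed by the disk automorphism that sends 1/K to
  0, so it fixes 0 and the Schwarz lemma gives |\<phi>(z)| \<le> |z|. Solving for \<open>g\<close>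
  turns this into the bound, whose extreme case is \<phi>(z) = -|z|.\<close>

lemma Re_deriv_ge_of_norm_less:
  fixes g :: "complex \<Rightarrow> complex"
  assumes hol: "g holomorphic_on ball 0 1" and "g 0 = 1"
    and bd: "\<And>z. z \<in> ball 0 1 \<Longrightarrow> norm (g z) < K"
    and z: "z \<in> ball 0 1"
  shows "Re (g z) \<ge> K * ((1 - K * norm z) / (K - norm z))"
proof -
  have K: "K > 1" using bd[of 0] \<open>g 0 = 1\<close> by simp
  define \<phi> where "\<phi> = (\<lambda>z. of_real K * (g z - 1) / (of_real (K\<^sup>2) - g z))"
  have nz: "of_real (K\<^sup>2) - g w \<noteq> 0" if "w \<in> ball 0 1" for w
  proof
    assume "of_real (K\<^sup>2) - g w = 0"
    then have "g w = of_real (K\<^sup>2)" by simp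
    then have "norm (g w) = K\<^sup>2" by (simp only: norm_of_real) auto
    moreover have "K\<^sup>2 > K" using K by (simp add: power2_eq_square)
    ultimately show False using bd[OF that] by simp
  qed
  have lt: "norm (\<phi> w) < 1" if "norm w < 1" for w
  proof -
    define x y where "x = Re (g w)" and "y = Im (g w)"
    have g: "g w = Complex x y" by (simp add: x_def y_def)
    have "(norm (g w))\<^sup>2 < K\<^sup>2"
      using bd[of w] that by (intro power_strict_mono) auto
    then have xy: "x\<^sup>2 + y\<^sup>2 < K\<^sup>2" by (simp add: g cmod_power2)
    \<comment> \<open>This product equals |K^2 - g|^2 - |K(g - 1)|^2, with g taken at
      \<open>w\<close>.\<close>
    have "0 < (K\<^sup>2 - 1) * (K\<^sup>2 - (x\<^sup>2 + y\<^sup>2))"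
      using xy K by (intro mult_pos_pos) (auto simp: power2_eq_square less_1_mult)
    then have "(norm (of_real K * (g w - 1)))\<^sup>2 < (norm (of_real (K\<^sup>2) - g w))\<^sup>2"
      unfolding cmod_power2 g by (simp add: power2_eq_square algebra_simps)
    then have "norm (of_real K * (g w - 1)) < norm (of_real (K\<^sup>2) - g w)"
      by (rule power_less_imp_less_base) simp
    then show ?thesis
      using nz[of w] that by (simp add: \<phi>_def norm_divide divide_less_eq)
  qed
  have "\<phi> holomorphic_on ball 0 1"
    unfolding \<phi>_def using nz by (intro holomorphic_intros hol) auto
  then have le: "norm (\<phi> z) \<le> norm z"
    using lt z \<open>g 0 = 1\<close> by (intro Schwarz_Lemma) (auto simp: \<phi>_def)
  have nz': "of_real K + \<phi> z \<noteq> 0"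
  proof
    assume "of_real K + \<phi> z = 0"
    then have "\<phi> z = - of_real K" by (simp add: add_eq_0_iff2)
    then have "norm (\<phi> z) = K" using K by simp
    then show False using lt[of z] z K by simp
  qed
  have "\<phi> z * (of_real (K\<^sup>2) - g z) = of_real K * (g z - 1)"
    using nz[OF z] by (simp add: \<phi>_def)
  \<comment> \<open>The inverse automorphism in partial fractions: \<open>\<phi> z\<close> then
    occurs only in 1/(K + \<phi>), whose coefficient has a known sign.\<close>
  then have "g z * (of_real K + \<phi> z) = of_real (K\<^sup>2) * (of_real K + \<phi> z) - of_real (K ^ 3 - K)"
    by (simp add: algebra_simps power3_eq_cube power2_eq_square)
  then have g: "g z = of_real (K\<^sup>2) - of_real (K ^ 3 - K) * inverse (of_real K + \<phi> z)"
    using nz' by (simp add: field_simps)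
  have Kz: "K - norm z > 0" using K z by simp
  have "Re (inverse (of_real K + \<phi> z)) \<le> norm (inverse (of_real K + \<phi> z))"
    by (rule complex_Re_le_cmod)
  also have "\<dots> = inverse (norm (of_real K + \<phi> z))" by (rule norm_inverse)
  also have "\<dots> \<le> inverse (K - norm z)"
  proof (rule le_imp_inverse_le[OF _ Kz])
    have "norm (of_real K :: complex) - norm (\<phi> z) \<le> norm (of_real K + \<phi> z)"
      by (rule norm_diff_ineq)
    then show "K - norm z \<le> norm (of_real K + \<phi> z)" using le K by simp
  qed
  finally have inv: "Re (inverse (of_real K + \<phi> z)) \<le> inverse (K - norm z)" .
  have K3: "K ^ 3 - K \<ge> 0"
  proof -
    have "K ^ 1 \<le> K ^ 3" using K by (intro power_increasing) auto
    then show ?thesis by simp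
  qed
  have "K * ((1 - K * norm z) / (K - norm z)) = K\<^sup>2 - (K ^ 3 - K) * inverse (K - norm z)"
    using Kz by (simp add: field_simps power3_eq_cube power2_eq_square)
  also have "\<dots> \<le> K\<^sup>2 - (K ^ 3 - K) * Re (inverse (of_real K + \<phi> z))"
    using inv K3 by (intro diff_left_mono mult_left_mono) auto
  also have "\<dots> = Re (g z)"
    unfolding g by (simp only: minus_complex.sel Re_complex_of_real times_complex.sel
        Im_complex_of_real mult_zero_left diff_zero)
  finally show ?thesis .
qed

section \<open>Directional derivatives of poly-analytic functions\<close>

text \<open>\<open>F\<close> need not be complex differentiable, so it is differentiated along real
  lines, term by term with the product rule. The term k = 0 stands apart because it carries no
  conjugate.\<close>

lemma polyanalytic_with_has_vector_derivative:
  assumes F: "polyanalytic_with m f F S" and S: "open S" and "m \<ge> 1"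
    and z: "z + of_real t * w \<in> S"
  shows "((\<lambda>s. F (z + of_real s * w)) has_vector_derivative
     (let \<zeta> = z + of_real t * w in
      deriv (f 0) \<zeta> * w + (\<Sum>k\<in>{1..<m}. of_nat k * cnj \<zeta> ^ (k - 1) * cnj w * f k \<zeta>
         + cnj \<zeta> ^ k * (deriv (f k) \<zeta> * w)))) (at t)"
proof -
  define \<zeta> where "\<zeta> = z + of_real t * w"
  have hol: "f k holomorphic_on S" if "k < m" for k
    using F that by (auto simp: polyanalytic_with_def)
  have line: "((\<lambda>s. z + of_real s * w) has_vector_derivative w) (at t)"
    by (auto intro!: derivative_eq_intros)
  have df: "((\<lambda>s. f k (z + of_real s * w)) has_vector_derivative deriv (f k) \<zeta> * w) (at t)"
    if "k < m" for k
  proof -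
    have "(f k has_field_derivative deriv (f k) \<zeta>) (at \<zeta>)"
      using hol[OF that] S z by (intro holomorphic_derivI) (auto simp: \<zeta>_def)
    then show ?thesis
      using field_vector_diff_chain_at[OF line, of "f k" "deriv (f k) \<zeta>"]
      by (simp add: o_def \<zeta>_def mult.commute)
  qed
  \<comment> \<open>The conjugate of a line is again a line, with direction \<open>cnj w\<close>.
    The chain rule thus applies to the holomorphic power u^k, and \<open>cnj\<close> itself is never
    differentiated as a complex function.\<close>
  have cline: "((\<lambda>s. cnj z + of_real s * cnj w) has_vector_derivative cnj w) (at t)"
    by (auto intro!: derivative_eq_intros)
  have dc: "((\<lambda>s. cnj (z + of_real s * w) ^ k) has_vector_derivative
      of_nat k * cnj \<zeta> ^ (k - 1) * cnj w) (at t)" for k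
  proof -
    have "((\<lambda>u. u ^ k) has_field_derivative of_nat k * cnj \<zeta> ^ (k - 1)) (at (cnj \<zeta>))"
      by (auto intro!: derivative_eq_intros)
    then show ?thesis
      using field_vector_diff_chain_at[OF cline, of "\<lambda>u. u ^ k" "of_nat k * cnj \<zeta> ^ (k - 1)"]
      by (simp add: o_def \<zeta>_def mult.commute)
  qed
  have "((\<lambda>s. \<Sum>k<m. cnj (z + of_real s * w) ^ k * f k (z + of_real s * w)) has_vector_derivative
      (\<Sum>k<m. cnj \<zeta> ^ k * (deriv (f k) \<zeta> * w) + of_nat k * cnj \<zeta> ^ (k - 1) * cnj w * f k \<zeta>)) (at t)"
    using df dc
    by (intro has_vector_derivative_sum) (auto simp: \<zeta>_def intro: has_vector_derivative_mult)
  also have "{..<m} = insert 0 {1..<m}" using \<open>m \<ge> 1\<close> by auto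
  finally have D: "((\<lambda>s. \<Sum>k<m. cnj (z + of_real s * w) ^ k * f k (z + of_real s * w)) has_vector_derivative
      (deriv (f 0) \<zeta> * w + (\<Sum>k\<in>{1..<m}. of_nat k * cnj \<zeta> ^ (k - 1) * cnj w * f k \<zeta>
         + cnj \<zeta> ^ k * (deriv (f k) \<zeta> * w)))) (at t)"
    by (simp add: \<open>{..<m} = insert 0 {1..<m}\<close> add.commute)
  \<comment> \<open>\<open>F\<close> is known to equal the sum only on \<open>S\<close>; openness of
    this set of parameters makes them agree near \<open>t\<close>.\<close>
  have "open ((\<lambda>s. z + of_real s * w) -` S)"
    by (intro open_vimage S continuous_intros)
  with D z show ?thesis
    unfolding Let_def \<zeta>_def[symmetric]
    by (elim has_vector_derivative_transform_within_open)
       (use F in \<open>auto simp: polyanalytic_with_def \<zeta>_def\<close>)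
qed


text \<open>The terms with k \<ge> 1 have zero derivative at 0, so the derivative in direction
  \<open>w\<close> is f_0'(0) w; the directions 1 and \<open>\<i>\<close> then give the average of
  two equal numbers.\<close>

lemma wirtinger_z_polyanalytic_at_0:
  assumes F: "polyanalytic_with m f F (ball 0 1)" and "m \<ge> 1"
    and zero: "\<And>k. k \<in> {1..<m} \<Longrightarrow> f k 0 = 0"
  shows "wirtinger_z F 0 = deriv (f 0) 0"
proof -
  have D: "((\<lambda>s. F (of_real s * w)) has_vector_derivative deriv (f 0) 0 * w) (at 0)" for w
  proof -
    \<comment> \<open>For k = 1 the factor \<open>0 ^ (k - 1)\<close> is 1, so the first summand
      vanishes only because \<open>f k 0\<close> does.\<close>
    have "(\<Sum>k\<in>{1..<m}. of_nat k * 0 ^ (k - 1) * cnj w * f k 0 + 0 ^ k * (deriv (f k) 0 * w)) = 0"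
      using zero by (intro sum.neutral) auto
    then show ?thesis
      using polyanalytic_with_has_vector_derivative[OF F _ \<open>m \<ge> 1\<close>, of 0 0 w] by (simp add: Let_def)
  qed
  have "(\<lambda>y::real. F (0 + \<i> * of_real y)) = (\<lambda>y. F (of_real y * \<i>))"
    by (simp add: mult.commute)
  moreover have "\<i> * (deriv (f 0) 0 * \<i>) = - deriv (f 0) 0"
    by (simp add: complex_eq_iff)
  ultimately show ?thesis
    using D[of 1, THEN vector_derivative_at] D[of \<i>, THEN vector_derivative_at]
    by (simp add: wirtinger_z_def)
qed

section \<open>The root equation and its primitive\<close>

text \<open>This is the function L; a name for it allows statements about its sign away from the
  root.\<close>

definition landau_fun :: "nat \<Rightarrow> (nat \<Rightarrow> nat) \<Rightarrow> (nat \<Rightarrow> real) \<Rightarrow> real \<Rightarrow> real" where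
  "landau_fun m p M r = M 0 * ((1 - M 0 * r) / (M 0 - r))
     - (\<Sum>k\<in>{1..<m}. real (k + p k) * M k * (r ^ (k + p k - 1) / fact (p k)))"

lemma is_landau_root_iff: "is_landau_root m p M r \<longleftrightarrow> 0 < r \<and> r < 1 \<and> landau_fun m p M r = 0"
  by (auto simp: is_landau_root_def landau_fun_def)

text \<open>In partial fractions the first term is K^2 - (K^3 - K)/(K - r) with K =
  \<open>M 0\<close>, strictly decreasing because K^3 > K; the subtracted sum is
  nondecreasing.\<close>

lemma landau_fun_strict_antimono:
  assumes "M 0 > 1" and "\<And>k. k \<in> {1..<m} \<Longrightarrow> M k \<ge> 0" and "0 \<le> r" "r < s" "s \<le> 1"
  shows "landau_fun m p M s < landau_fun m p M r"
proof -
  have eq: "M 0 * ((1 - M 0 * x) / (M 0 - x)) = (M 0)\<^sup>2 - (M 0 ^ 3 - M 0) / (M 0 - x)" if "x \<le> 1" for x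
    using that \<open>M 0 > 1\<close> by (simp add: field_simps power3_eq_cube power2_eq_square)
  have "M 0 ^ 1 < M 0 ^ 3" using \<open>M 0 > 1\<close> by (intro power_strict_increasing) auto
  then have "(M 0 ^ 3 - M 0) / (M 0 - r) < (M 0 ^ 3 - M 0) / (M 0 - s)"
    using assms by (intro divide_strict_left_mono) auto
  moreover have "(\<Sum>k\<in>{1..<m}. real (k + p k) * M k * (r ^ (k + p k - 1) / fact (p k)))
      \<le> (\<Sum>k\<in>{1..<m}. real (k + p k) * M k * (s ^ (k + p k - 1) / fact (p k)))"
    using assms by (intro sum_mono mult_left_mono divide_right_mono power_mono mult_nonneg_nonneg) auto
  ultimately show ?thesis
    unfolding landau_fun_def using eq[of r] eq[of s] assms by linarith
qed

lemma continuous_on_landau_fun: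
  assumes "M 0 > 1"
  shows "continuous_on {0..1} (landau_fun m p M)"
  unfolding landau_fun_def using assms by (intro continuous_intros) auto

text \<open>L(0) = 1 and L(1) < 0, so the intermediate value theorem gives a root and strict
  monotonicity makes it unique.\<close>

lemma ex1_landau_root:
  assumes M0: "M 0 > 1" and M: "\<And>k. k \<in> {1..<m} \<Longrightarrow> M k \<ge> 0"
    and p: "\<And>k. k \<in> {1..<m} \<Longrightarrow> p k \<ge> 1"
  shows "\<exists>!r. is_landau_root m p M r"
proof (rule ex_ex1I)
  have "(\<Sum>k\<in>{1..<m}. real (k + p k) * M k * (0 ^ (k + p k - 1) / fact (p k))) = 0"
  proof (intro sum.neutral ballI)
    fix k assume "k \<in> {1..<m}"
    \<comment> \<open>A zero exponent would leave a nonzero term at 0, since \<open>0 ^ 0\<close> is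
      1.\<close>
    then have "k + p k - 1 \<noteq> 0" using p[of k] by auto
    then show "real (k + p k) * M k * (0 ^ (k + p k - 1) / fact (p k)) = 0" by simp
  qed
  then have L0: "landau_fun m p M 0 = 1"
    using M0 unfolding landau_fun_def by simp
  have "M 0 * ((1 - M 0 * 1) / (M 0 - 1)) = - M 0"
    using M0 by (simp add: field_simps)
  moreover have "(\<Sum>k\<in>{1..<m}. real (k + p k) * M k * (1 ^ (k + p k - 1) / fact (p k))) \<ge> 0"
    using M by (intro sum_nonneg) auto
  ultimately have L1: "landau_fun m p M 1 < 0"
    using M0 unfolding landau_fun_def by linarith
  obtain r where r: "0 \<le> r" "r \<le> 1" "landau_fun m p M r = 0"
    using IVT2'[of "landau_fun m p M" 1 0 0] L0 L1 continuous_on_landau_fun[where M = M, OF M0] by auto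
  then have "is_landau_root m p M r"
    using L0 L1 by (cases "r = 0"; cases "r = 1") (auto simp: is_landau_root_iff)
  then show "\<exists>r. is_landau_root m p M r" ..
  fix r s
  assume "is_landau_root m p M r" "is_landau_root m p M s"
  then show "r = s"
    using landau_fun_strict_antimono[of M m r s p] landau_fun_strict_antimono[of M m s r p] M0 M
    by (cases r s rule: linorder_cases) (auto simp: is_landau_root_iff)
qed

lemma landau_fun_pos:
  assumes "M 0 > 1" and "\<And>k. k \<in> {1..<m} \<Longrightarrow> M k \<ge> 0"
    and "is_landau_root m p M r" and "0 \<le> s" "s < r"
  shows "landau_fun m p M s > 0"
  using landau_fun_strict_antimono[of M m s r p] assms by (auto simp: is_landau_root_iff)

lemma landau_fun_neg:
  assumes "M 0 > 1" and "\<And>k. k \<in> {1..<m} \<Longrightarrow> M k \<ge> 0"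
    and "is_landau_root m p M r" and "r < s" "s \<le> 1"
  shows "landau_fun m p M s < 0"
  using landau_fun_strict_antimono[of M m r s p] assms by (auto simp: is_landau_root_iff)

lemma schlicht_radius_has_real_derivative:
  assumes "M 0 > 1" "r \<le> 1"
  shows "(schlicht_radius m p M has_real_derivative landau_fun m p M r) (at r)"
proof -
  have "((\<lambda>r. ln (1 - r / M 0)) has_real_derivative (- 1 / (M 0 - r))) (at r)"
    using assms by (auto intro!: derivative_eq_intros simp: field_simps)
  then have "((\<lambda>r. (M 0)\<^sup>2 * r + ((M 0) ^ 3 - M 0) * ln (1 - r / M 0)
       - (\<Sum>k\<in>{1..<m}. M k * (r ^ (p k + k) / fact (p k)))) has_real_derivative
      (M 0)\<^sup>2 * 1 + ((M 0) ^ 3 - M 0) * (- 1 / (M 0 - r))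
       - (\<Sum>k\<in>{1..<m}. M k * (real (p k + k) * r ^ (p k + k - 1) / fact (p k)))) (at r)"
    by (intro DERIV_diff DERIV_add DERIV_cmult DERIV_sum DERIV_ident)
      (auto intro!: derivative_eq_intros)
  moreover have "(\<Sum>k\<in>{1..<m}. M k * (real (p k + k) * r ^ (p k + k - 1) / fact (p k)))
      = (\<Sum>k\<in>{1..<m}. real (k + p k) * M k * (r ^ (k + p k - 1) / fact (p k)))"
    by (intro sum.cong) (auto simp: add.commute)
  moreover have "M 0 * ((1 - M 0 * r) / (M 0 - r)) = (M 0)\<^sup>2 * 1 + ((M 0) ^ 3 - M 0) * (- 1 / (M 0 - r))"
    using assms by (simp add: field_simps power3_eq_cube power2_eq_square)
  ultimately show ?thesis
    unfolding landau_fun_def schlicht_radius_def by simp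
qed

lemma schlicht_radius_0:
  assumes "\<And>k. k \<in> {1..<m} \<Longrightarrow> p k \<ge> 1"
  shows "schlicht_radius m p M 0 = 0"
  using assms by (auto simp: schlicht_radius_def intro!: sum.neutral)

lemma continuous_on_schlicht_radius:
  assumes "M 0 > 1" "b \<le> 1"
  shows "continuous_on {a..b} (schlicht_radius m p M)"
  using assms
  by (intro continuous_at_imp_continuous_on ballI DERIV_isCont[OF schlicht_radius_has_real_derivative[where M = M]]) auto

text \<open>R starts at 0 and its derivative L is positive before the root.\<close>

lemma schlicht_radius_pos:
  assumes M0: "M 0 > 1" and M: "\<And>k. k \<in> {1..<m} \<Longrightarrow> M k \<ge> 0"
    and p: "\<And>k. k \<in> {1..<m} \<Longrightarrow> p k \<ge> 1" and root: "is_landau_root m p M r"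
  shows "schlicht_radius m p M r > 0"
proof -
  have r: "0 < r" "r < 1" using root by (auto simp: is_landau_root_iff)
  have "schlicht_radius m p M 0 < schlicht_radius m p M r"
  proof (rule DERIV_pos_imp_increasing_open[where f = "schlicht_radius m p M"])
    show "\<exists>y. DERIV (schlicht_radius m p M) x :> y \<and> y > 0" if "0 < x" "x < r" for x
      using schlicht_radius_has_real_derivative[of M x m p] landau_fun_pos[of M m p r x] that r M0 M root
      by (auto intro!: exI[of _ "landau_fun m p M x"])
  qed (use r continuous_on_schlicht_radius M0 in auto)
  then show ?thesis using schlicht_radius_0[of m p M] p by simp
qed

section \<open>Lower bound for the directional derivative\<close>

text \<open>Since p_k \<ge> 1, all f_k with k \<ge> 1 vanish at 0. The normalisation of
  \<open>F\<close> therefore reads f_0'(0) = 1, and the strict bound on f_0' at 0 gives the first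
  claim.\<close>

lemma landau_hyps_imp:
  assumes hyps: "landau_hyps m p M f F" and m: "m \<ge> 1"
    and p: "\<And>k. k \<in> {1..<m} \<Longrightarrow> p k \<ge> 1"
  shows "M 0 > 1" and "deriv (f 0) 0 = 1" and "F 0 = 0"
proof -
  have poly: "polyanalytic_with m f F (ball 0 1)" using hyps by (simp add: landau_hyps_def)
  have zero: "f k 0 = 0" if "k \<in> {1..<m}" for k
  proof -
    have "(deriv ^^ 0) (f k) 0 = 0" using hyps that p[OF that] unfolding landau_hyps_def by fastforce
    then show ?thesis by simp
  qed
  show d: "deriv (f 0) 0 = 1"
    using wirtinger_z_polyanalytic_at_0[OF poly m zero] hyps by (simp add: landau_hyps_def)
  have "norm (deriv (f 0) 0) < M 0" using hyps by (auto simp: landau_hyps_def)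
  then show "M 0 > 1" using d by simp
  have "f k 0 = 0" if "k < m" for k
    using zero[of k] that hyps by (cases "k = 0") (auto simp: landau_hyps_def)
  then show "F 0 = 0" using poly by (simp add: polyanalytic_with_def)
qed

text \<open>The holomorphic part contributes Re f_0' times |w|^2, bounded by the Schwarz estimate;
  the other terms are bounded in modulus. The direction is arbitrary because injectivity uses chords
  and the covering uses radii.\<close>

lemma Re_directional_derivative_ge:
  assumes hyps: "landau_hyps m p M f F" and m: "m \<ge> 1"
    and p: "\<And>k. k \<in> {1..<m} \<Longrightarrow> p k \<ge> 1" and z: "z + of_real t * w \<in> ball 0 1"
  obtains D where "((\<lambda>s. F (z + of_real s * w)) has_vector_derivative D) (at t)"
    and "landau_fun m p M (norm (z + of_real t * w)) * (norm w)\<^sup>2 \<le> Re (cnj w * D)"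
proof -
  define \<zeta> where "\<zeta> = z + of_real t * w"
  define T where "T = (\<lambda>k. of_nat k * cnj \<zeta> ^ (k - 1) * cnj w * f k \<zeta> + cnj \<zeta> ^ k * (deriv (f k) \<zeta> * w))"
  have \<zeta>: "\<zeta> \<in> ball 0 1" using z by (simp add: \<zeta>_def)
  have poly: "polyanalytic_with m f F (ball 0 1)" using hyps by (simp add: landau_hyps_def)
  have hol: "f k holomorphic_on ball 0 1" if "k < m" for k
    using poly that by (simp add: polyanalytic_with_def)
  have D: "((\<lambda>s. F (z + of_real s * w)) has_vector_derivative
      deriv (f 0) \<zeta> * w + (\<Sum>k\<in>{1..<m}. T k)) (at t)"
    using polyanalytic_with_has_vector_derivative[OF poly _ m z] by (simp add: Let_def \<zeta>_def T_def)
  have "Re (deriv (f 0) \<zeta>) \<ge> M 0 * ((1 - M 0 * norm \<zeta>) / (M 0 - norm \<zeta>))"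
  proof (rule Re_deriv_ge_of_norm_less[OF _ _ _ \<zeta>])
    show "deriv (f 0) holomorphic_on ball 0 1" using hol[of 0] m by (intro holomorphic_deriv) auto
    show "deriv (f 0) 0 = 1" using landau_hyps_imp(2)[OF hyps m p] .
    show "norm (deriv (f 0) u) < M 0" if "u \<in> ball 0 1" for u
      using hyps that by (simp add: landau_hyps_def)
  qed
  then have "M 0 * ((1 - M 0 * norm \<zeta>) / (M 0 - norm \<zeta>)) * (norm w)\<^sup>2 \<le> Re (deriv (f 0) \<zeta>) * (norm w)\<^sup>2"
    by (intro mult_right_mono) auto
  also have "\<dots> = Re (cnj w * (deriv (f 0) \<zeta> * w))"
  proof -
    \<comment> \<open>Multiplying by \<open>cnj w\<close> makes the direction a nonnegative real
      factor, so only the real part of f_0' matters.\<close>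
    have "cnj w * (deriv (f 0) \<zeta> * w) = deriv (f 0) \<zeta> * of_real ((norm w)\<^sup>2)"
      by (simp only: complex_norm_square mult_ac)
    then show ?thesis
      by (simp only: times_complex.sel Re_complex_of_real Im_complex_of_real mult_zero_right diff_zero)
  qed
  finally have main: "M 0 * ((1 - M 0 * norm \<zeta>) / (M 0 - norm \<zeta>)) * (norm w)\<^sup>2
    \<le> Re (cnj w * (deriv (f 0) \<zeta> * w))" .
  have T: "norm (T k) \<le> real (k + p k) * M k * (norm \<zeta> ^ (k + p k - 1) / fact (p k)) * norm w"
    if k: "k \<in> {1..<m}" for k
  proof -
    define x where "x = norm \<zeta>"
    have holk: "f k holomorphic_on ball 0 1" using hol k by auto
    have v: "(deriv ^^ j) (f k) 0 = 0" if "j < p k" for j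
      using hyps k that by (auto simp: landau_hyps_def)
    have b: "norm ((deriv ^^ p k) (f k) u) \<le> M k" if "u \<in> ball 0 1" for u
      using hyps k that by (auto simp: landau_hyps_def)
    obtain q where q: "p k = Suc q" using p[OF k] by (cases "p k") auto
    obtain l where l: "k = Suc l" using k by (cases k) auto
    have f0: "norm (f k \<zeta>) \<le> M k * x ^ p k / fact (p k)"
      unfolding x_def using norm_le_of_higher_deriv_le[OF holk v b \<zeta>] .
    \<comment> \<open>The growth lemma once more, for f_k' with q = p_k - 1: its derivative of order
      q is the derivative of order p_k of f_k.\<close>
    have "norm (deriv (f k) \<zeta>) \<le> M k * x ^ q / fact q"
      unfolding x_def
    proof (rule norm_le_of_higher_deriv_le[OF _ _ _ \<zeta>])
      show "deriv (f k) holomorphic_on ball 0 1" using holk by (intro holomorphic_deriv) auto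
      show "(deriv ^^ j) (deriv (f k)) 0 = 0" if "j < q" for j
        using v[of "Suc j"] that q by (simp add: funpow_Suc_right del: funpow.simps)
      show "norm ((deriv ^^ q) (deriv (f k)) u) \<le> M k" if "u \<in> ball 0 1" for u
        using b[OF that] q by (simp add: funpow_Suc_right del: funpow.simps)
    qed
    \<comment> \<open>With 1/q! = p_k/p_k! both halves of \<open>T k\<close> have the same
      denominator, and their coefficients k and p_k add up.\<close>
    then have f1: "norm (deriv (f k) \<zeta>) \<le> real (p k) * (M k * x ^ q / fact (p k))"
      by (simp add: q field_simps del: of_nat_Suc)
    have x: "x \<ge> 0" by (simp add: x_def)
    have "norm (T k) \<le> real k * x ^ l * norm w * norm (f k \<zeta>) + x ^ k * (norm (deriv (f k) \<zeta>) * norm w)"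
      unfolding T_def by (rule order_trans[OF norm_triangle_ineq]) (simp add: norm_mult norm_power x_def l del: of_nat_Suc)
    also have "\<dots> \<le> real k * x ^ l * norm w * (M k * x ^ p k / fact (p k))
        + x ^ k * (real (p k) * (M k * x ^ q / fact (p k)) * norm w)"
      using f0 f1 x by (intro add_mono mult_left_mono mult_right_mono) auto
    also have "\<dots> = real (k + p k) * M k * (x ^ (k + p k - 1) / fact (p k)) * norm w"
      by (simp add: q[unfolded l] l power_add field_simps del: fact_Suc)
    finally show ?thesis by (simp add: x_def)
  qed
  have "norm (cnj w * (\<Sum>k\<in>{1..<m}. T k)) \<le> norm w * (\<Sum>k\<in>{1..<m}. norm (T k))"
    by (simp add: norm_mult mult_left_mono norm_sum)
  also have "\<dots> \<le> norm w * (\<Sum>k\<in>{1..<m}. real (k + p k) * M k * (norm \<zeta> ^ (k + p k - 1) / fact (p k)) * norm w)"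
    using T by (intro mult_left_mono sum_mono) auto
  also have "\<dots> = (\<Sum>k\<in>{1..<m}. real (k + p k) * M k * (norm \<zeta> ^ (k + p k - 1) / fact (p k))) * (norm w)\<^sup>2"
    by (simp add: sum_distrib_left sum_distrib_right power2_eq_square mult_ac)
  finally have "Re (cnj w * (\<Sum>k\<in>{1..<m}. T k)) \<ge>
      - ((\<Sum>k\<in>{1..<m}. real (k + p k) * M k * (norm \<zeta> ^ (k + p k - 1) / fact (p k))) * (norm w)\<^sup>2)"
    using abs_Re_le_cmod[of "cnj w * (\<Sum>k\<in>{1..<m}. T k)"] by linarith
  with main have "landau_fun m p M (norm \<zeta>) * (norm w)\<^sup>2
      \<le> Re (cnj w * (deriv (f 0) \<zeta> * w)) + Re (cnj w * (\<Sum>k\<in>{1..<m}. T k))"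
    unfolding landau_fun_def left_diff_distrib by linarith
  also have "\<dots> = Re (cnj w * (deriv (f 0) \<zeta> * w + (\<Sum>k\<in>{1..<m}. T k)))"
    by (simp only: distrib_left plus_complex.sel)
  finally show thesis using that[OF D] by (simp add: \<zeta>_def)
qed

section \<open>Injectivity and growth along radii\<close>

lemma polyanalytic_with_continuous_on:
  assumes "polyanalytic_with m f F S"
  shows "continuous_on S F"
proof -
  have "continuous_on S (\<lambda>z. \<Sum>k<m. cnj z ^ k * f k z)"
    using assms by (intro continuous_intros holomorphic_on_imp_continuous_on)
      (auto simp: polyanalytic_with_def)
  then show ?thesis
    using assms by (subst continuous_on_cong[OF refl]) (auto simp: polyanalytic_with_def)
qed

lemma DERIV_Re_mult_along_line:
  assumes "((\<lambda>s. F (z + of_real s * w)) has_vector_derivative D) (at t)"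
  shows "((\<lambda>s. Re (c * F (z + of_real s * w))) has_real_derivative Re (c * D)) (at t)"
  using bounded_linear.has_vector_derivative[OF bounded_linear_Re
      has_vector_derivative_mult_right[OF assms, of c]]
  by (simp add: has_real_derivative_iff_has_vector_derivative)

text \<open>
  Up to the boundary circle: this is what keeps \<open>schlicht_radius m p M r\<close> out of the image of the
  open disk in the sharpness part.
\<close>

lemma landau_inj_on_cball:
  assumes hyps: "landau_hyps m p M f F" and m: "m \<ge> 1"
    and p: "\<And>k. k \<in> {1..<m} \<Longrightarrow> p k \<ge> 1" and M: "\<And>k. k \<in> {1..<m} \<Longrightarrow> M k \<ge> 0"
    and root: "is_landau_root m p M r"
  shows "inj_on F (cball 0 r)"
proof (rule inj_onI, rule ccontr)
  fix a b
  assume a: "a \<in> cball 0 r" and b: "b \<in> cball 0 r" and eq: "F a = F b" and "a \<noteq> b"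
  define w where "w = b - a"
  define \<psi> where "\<psi> = (\<lambda>s. Re (cnj w * F (a + of_real s * w)))"
  have w: "w \<noteq> 0" using \<open>a \<noteq> b\<close> by (simp add: w_def)
  have r: "r < 1" using root by (simp add: is_landau_root_iff)
  have M0: "M 0 > 1" using landau_hyps_imp(1)[OF hyps m p] .
  have line: "a + of_real t * w = (1 - t) *\<^sub>R a + t *\<^sub>R b" for t :: real
    by (simp add: w_def scaleR_conv_of_real algebra_simps)
  \<comment> \<open>Strict convexity: even if both ends lie on the circle, where L vanishes, the
    interior of the chord stays in the open disk, where L > 0. Strict increase needs a positive
    derivative only there.\<close>
  have inside: "a + of_real t * w \<in> ball 0 r" if "0 < t" "t < 1" for t :: real
  proof -
    have "a + of_real t * w \<in> open_segment a b"
      using \<open>a \<noteq> b\<close> that line by (auto simp: in_segment)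
    then have "dist 0 (a + of_real t * w) < dist 0 a \<or> dist 0 (a + of_real t * w) < dist 0 b"
      by (rule dist_decreases_open_segment)
    then show ?thesis using a b by auto
  qed
  have closed: "a + of_real t * w \<in> cball 0 r" if "0 \<le> t" "t \<le> 1" for t :: real
    unfolding line using a b that by (intro convexD) auto
  have "\<psi> 0 < \<psi> 1"
  proof (rule DERIV_pos_imp_increasing_open[where f = \<psi>])
    show "\<exists>y. DERIV \<psi> t :> y \<and> y > 0" if t: "0 < t" "t < 1" for t
    proof -
      have "a + of_real t * w \<in> ball 0 1" using inside[OF t] r by auto
      then obtain D where D: "((\<lambda>s. F (a + of_real s * w)) has_vector_derivative D) (at t)"
        and ge: "landau_fun m p M (norm (a + of_real t * w)) * (norm w)\<^sup>2 \<le> Re (cnj w * D)"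
        using Re_directional_derivative_ge[OF hyps m p] by blast
      have "landau_fun m p M (norm (a + of_real t * w)) > 0"
        using inside[OF t] by (intro landau_fun_pos[where M = M, OF M0 M root]) auto
      then have "landau_fun m p M (norm (a + of_real t * w)) * (norm w)\<^sup>2 > 0"
        using w by simp
      then show ?thesis
        using DERIV_Re_mult_along_line[OF D, of "cnj w"] ge unfolding \<psi>_def by fastforce
    qed
    have "continuous_on (ball 0 1) F"
      using hyps by (intro polyanalytic_with_continuous_on) (auto simp: landau_hyps_def)
    moreover have "continuous_on {0..1} (\<lambda>s::real. a + of_real s * w)"
      by (intro continuous_intros)
    moreover have "(\<lambda>s::real. a + of_real s * w) ` {0..1} \<subseteq> ball 0 1"
    proof (rule image_subsetI)
      show "a + of_real s * w \<in> ball 0 1" if "s \<in> {0..1}" for s :: real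
        using closed[of s] that r by simp
    qed
    ultimately have "continuous_on {0..1} (\<lambda>s::real. F (a + of_real s * w))"
      by (rule continuous_on_compose2)
    then show "continuous_on {0..1} \<psi>"
      unfolding \<psi>_def by (intro continuous_intros)
  qed simp
  then show False using eq by (simp add: \<psi>_def w_def)
qed

text \<open>Along the radius through \<open>z\<close>, with unit direction \<open>u\<close>, the
  derivative of Re(\<open>cnj u\<close> F(su)) is at least L(s) = R'(s), and both functions start at
  0.\<close>

lemma landau_norm_ge:
  assumes hyps: "landau_hyps m p M f F" and m: "m \<ge> 1"
    and p: "\<And>k. k \<in> {1..<m} \<Longrightarrow> p k \<ge> 1" and z: "z \<in> ball 0 1" "z \<noteq> 0"
  shows "norm (F z) \<ge> schlicht_radius m p M (norm z)"
proof -
  define u where "u = sgn z"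
  define \<psi> where "\<psi> = (\<lambda>s. Re (cnj u * F (0 + of_real s * u)) - schlicht_radius m p M s)"
  have u: "norm u = 1" using z by (simp add: u_def norm_sgn)
  have M0: "M 0 > 1" using landau_hyps_imp(1)[OF hyps m p] .
  have "\<psi> 0 \<le> \<psi> (norm z)"
  proof (rule DERIV_nonneg_imp_nondecreasing[where f = \<psi>])
    fix t assume t: "0 \<le> t" "t \<le> norm z"
    then have n: "norm (0 + of_real t * u) = t" using u by (simp add: norm_mult)
    then have "0 + of_real t * u \<in> ball 0 1" unfolding mem_ball_0 n using t z by simp
    then obtain D where D: "((\<lambda>s. F (0 + of_real s * u)) has_vector_derivative D) (at t)"
      and ge: "landau_fun m p M (norm (0 + of_real t * u)) * (norm u)\<^sup>2 \<le> Re (cnj u * D)"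
      using Re_directional_derivative_ge[OF hyps m p] by blast
    have "(\<psi> has_real_derivative Re (cnj u * D) - landau_fun m p M t) (at t)"
      unfolding \<psi>_def using t z M0
      by (intro DERIV_diff DERIV_Re_mult_along_line[OF D] schlicht_radius_has_real_derivative[where M = M]) auto
    then show "\<exists>y. DERIV \<psi> t :> y \<and> y \<ge> 0"
      using ge unfolding n u by (intro exI[of _ "Re (cnj u * D) - landau_fun m p M t"]) auto
  qed simp
  moreover have "\<psi> 0 = 0"
    using landau_hyps_imp(3)[OF hyps m p] schlicht_radius_0[of m p M] p by (simp add: \<psi>_def)
  moreover have "of_real (norm z) * u = z"
    using z by (simp add: u_def sgn_eq)
  ultimately have "schlicht_radius m p M (norm z) \<le> Re (cnj u * F z)"
    by (simp add: \<psi>_def)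
  also have "\<dots> \<le> norm (cnj u * F z)" by (rule complex_Re_le_cmod)
  also have "\<dots> = norm (F z)" using u by (simp add: norm_mult)
  finally show ?thesis .
qed

section \<open>Covered and schlicht disks\<close>

text \<open>A connectedness argument: the trace \<open>?A\<close> of the image on
  \<open>ball 0 \<rho>\<close> is open by invariance of domain. It is also relatively closed, being
  the trace of the compact image of the closed ball, since the sphere is mapped outside
  \<open>ball 0 \<rho>\<close>.\<close>

lemma ball_subset_image_of_sphere_norm_ge:
  fixes F :: "'a::euclidean_space \<Rightarrow> 'a"
  assumes cont: "continuous_on (cball 0 r) F" and inj: "inj_on F (ball 0 r)"
    and "F 0 = 0" "0 < r" "0 < \<rho>"
    and sph: "\<And>z. z \<in> sphere 0 r \<Longrightarrow> norm (F z) \<ge> \<rho>"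
  shows "ball 0 \<rho> \<subseteq> F ` ball 0 r"
proof -
  let ?A = "ball 0 \<rho> \<inter> F ` ball 0 r"
  have "continuous_on (ball 0 r) F"
    using cont by (rule continuous_on_subset) auto
  then have "open (F ` ball 0 r)"
    using inj by (intro invariance_of_domain) auto
  then have op: "openin (top_of_set (ball 0 \<rho>)) ?A"
    by (rule openin_open_Int)
  have "compact (F ` cball 0 r)"
    using cont by (intro compact_continuous_image) auto
  then have "closedin (top_of_set (ball 0 \<rho>)) (ball 0 \<rho> \<inter> F ` cball 0 r)"
    by (intro closedin_closed_Int compact_imp_closed)
  also have "ball 0 \<rho> \<inter> F ` cball 0 r = ?A"
  proof -
    have "z \<in> ball 0 r" if "z \<in> cball 0 r" "F z \<in> ball 0 \<rho>" for z
      using sph[of z] that by (cases "norm z = r") auto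
    then show ?thesis by auto
  qed
  finally have cl: "closedin (top_of_set (ball 0 \<rho>)) ?A" .
  have "0 \<in> ?A"
    using \<open>F 0 = 0\<close> \<open>0 < r\<close> \<open>0 < \<rho>\<close> by (auto intro!: image_eqI[of _ _ 0])
  moreover have "connected (ball (0::'a) \<rho>)" by simp
  ultimately have "?A = ball 0 \<rho>"
    using op cl unfolding connected_clopen by blast
  then show ?thesis by blast
qed

text \<open>The region is the part of \<open>S\<close> that \<open>F\<close> maps into the disk. It
  is connected as the image of the disk under the inverse, which is continuous by invariance of
  domain.\<close>

lemma schlicht_diskI:
  assumes "open S" "continuous_on S F" "inj_on F S" "0 < \<rho>" "ball c \<rho> \<subseteq> F ` S"
  shows "schlicht_disk F S c \<rho>"
proof -
  obtain G where G: "homeomorphism S (F ` S) F G"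
    using invariance_of_domain_homeomorphism[of S F] assms by auto
  define U where "U = S \<inter> F -` ball c \<rho>"
  have "G ` ball c \<rho> = U"
    using G assms(5) unfolding homeomorphism_def U_def by (auto simp: image_iff) force+
  moreover have "connected (G ` ball c \<rho>)"
    using G assms(5) unfolding homeomorphism_def
    by (intro connected_continuous_image) (auto intro: continuous_on_subset)
  ultimately have "connected U" by simp
  moreover have "open U"
    unfolding U_def using assms by (intro continuous_open_preimage) auto
  moreover have "inj_on F U" using assms(3) by (rule inj_on_subset) (auto simp: U_def)
  moreover have "F ` U = ball c \<rho>" using assms(5) by (auto simp: U_def)
  ultimately show ?thesis
    unfolding schlicht_disk_def using assms(4) by (auto simp: U_def)
qed

section \<open>The extremal function\<close>

lemma deriv_funpow_monomial:
  fixes a :: complex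
  assumes "j \<le> n"
  shows "(deriv ^^ j) (\<lambda>z. a * z ^ n / fact n) = (\<lambda>z. a * z ^ (n - j) / fact (n - j))"
  using assms
proof (induction j)
  case 0
  then show ?case by simp
next
  case (Suc j)
  obtain l where l: "n - j = Suc l" using Suc.prems by (cases "n - j") auto
  have "deriv (\<lambda>z. a * z ^ Suc l / fact (Suc l)) z = a * z ^ l / fact l" for z
  proof (rule DERIV_imp_deriv)
    have "((\<lambda>z. a * z ^ Suc l / fact (Suc l)) has_field_derivative
        a * (of_nat (Suc l) * z ^ l) / fact (Suc l)) (at z)"
      by (auto intro!: derivative_eq_intros simp del: of_nat_Suc power_Suc fact_Suc)
    also have "a * (of_nat (Suc l) * z ^ l) / fact (Suc l) = a * z ^ l / fact l"
      by (simp add: field_simps del: of_nat_Suc)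
    finally show "((\<lambda>z. a * z ^ Suc l / fact (Suc l)) has_field_derivative a * z ^ l / fact l) (at z)" .
  qed
  moreover have "n - Suc j = l" using l by simp
  moreover have "(deriv ^^ Suc j) (\<lambda>z. a * z ^ n / fact n) = deriv (\<lambda>z. a * z ^ Suc l / fact (Suc l))"
    using Suc.IH Suc.prems unfolding l by simp
  ultimately show ?case by (simp only:)
qed

text \<open>The components are the holomorphic part \<open>f0\<close> and -M_k z^(p_k)/p_k!, whose
  derivative of order p_k is the constant -M_k. The derivative of \<open>f0\<close> is K times a
  disk automorphism, with value 1 at 0.\<close>

lemma extremal_G_landau_hyps:
  assumes M0: "M 0 > 1" and m: "m \<ge> 1" and M: "\<And>k. k \<in> {1..<m} \<Longrightarrow> M k \<ge> 0"
    and p: "\<And>k. k \<in> {1..<m} \<Longrightarrow> p k \<ge> 1"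
  shows "\<exists>f. landau_hyps m p M f (extremal_G m p M)"
proof -
  define K where "K = M 0"
  define f0 where "f0 = (\<lambda>z. of_real (K\<^sup>2) * z + of_real (K ^ 3 - K) * Ln (1 - z / of_real K))"
  define f :: "nat \<Rightarrow> complex \<Rightarrow> complex" where
    "f = (\<lambda>k. if k = 0 then f0 else (\<lambda>z. - of_real (M k) * z ^ p k / fact (p k)))"
  have K: "K > 1" using M0 by (simp add: K_def)
  \<comment> \<open>Both follow from a positive real part; the first keeps the argument of
    \<open>Ln\<close> off the branch cut.\<close>
  have slit: "1 - z / of_real K \<notin> \<real>\<^sub>\<le>\<^sub>0" and nz: "of_real K - z \<noteq> 0" if "z \<in> ball 0 1" for z :: complex
  proof -
    have "norm (z / of_real K) < 1" using that K by (simp add: norm_divide divide_less_eq)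
    then have "Re (1 - z / of_real K) > 0"
      using complex_Re_le_cmod[of "z / of_real K"] by simp
    then show "1 - z / of_real K \<notin> \<real>\<^sub>\<le>\<^sub>0" by (auto simp: complex_nonpos_Reals_iff)
    have "Re (of_real K - z) > 0"
      using that K complex_Re_le_cmod[of z] by simp
    then show "of_real K - z \<noteq> 0" by auto
  qed
  have df0: "(f0 has_field_derivative of_real K * (1 - of_real K * z) / (of_real K - z)) (at z)"
    if "z \<in> ball 0 1" for z
  proof -
    have "((\<lambda>z. Ln (1 - z / of_real K)) has_field_derivative
        (0 - 1 / of_real K) / (1 - z / of_real K)) (at z)"
      using slit[OF that] K by (auto intro!: derivative_eq_intros simp: field_simps)
    also have "(0 - 1 / of_real K) / (1 - z / of_real K) = - 1 / (of_real K - z)"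
      using nz[OF that] K by (simp add: divide_simps)
    finally have "(f0 has_field_derivative
        of_real (K\<^sup>2) * 1 + of_real (K ^ 3 - K) * (- 1 / (of_real K - z))) (at z)"
      unfolding f0_def by (intro DERIV_add DERIV_cmult DERIV_ident)
    also have "of_real (K\<^sup>2) * 1 + of_real (K ^ 3 - K) * (- 1 / (of_real K - z))
        = of_real K * (1 - of_real K * z) / (of_real K - z)"
      using nz[OF that] by (simp add: divide_simps) (simp add: algebra_simps power3_eq_cube power2_eq_square)
    finally show ?thesis .
  qed
  have bd0: "norm (of_real K * (1 - of_real K * z) / (of_real K - z)) < K" if "z \<in> ball 0 1" for z :: complex
  proof -
    have "(norm z)\<^sup>2 < 1\<^sup>2" using that by (intro power_strict_mono) auto
    \<comment> \<open>This product equals |K - z|^2 - |1 - Kz|^2.\<close>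
    then have "0 < (K\<^sup>2 - 1) * (1 - (norm z)\<^sup>2)"
      using K by (intro mult_pos_pos) (auto simp: power2_eq_square less_1_mult)
    then have "(norm (1 - of_real K * z))\<^sup>2 < (norm (of_real K - z))\<^sup>2"
      unfolding cmod_power2 by (simp add: power2_eq_square algebra_simps)
    then have "norm (1 - of_real K * z) < norm (of_real K - z)"
      by (rule power_less_imp_less_base) simp
    then have "K * norm (1 - of_real K * z) < K * norm (of_real K - z)" using K by simp
    then show ?thesis
      using nz[OF that] K by (simp add: norm_divide norm_mult divide_less_eq)
  qed
  have d0: "deriv (f 0) z = of_real K * (1 - of_real K * z) / (of_real K - z)" if "z \<in> ball 0 1" for z
    using DERIV_imp_deriv[OF df0[OF that]] by (simp add: f_def)
  have hol: "f k holomorphic_on ball 0 1" for k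
    using slit K by (cases "k = 0") (auto simp: f_def f0_def intro!: holomorphic_intros)
  have sum: "extremal_G m p M z = (\<Sum>k<m. cnj z ^ k * f k z)" for z
  proof -
    have "{..<m} = insert 0 {1..<m}" using m by auto
    then have "(\<Sum>k<m. cnj z ^ k * f k z) = f0 z + (\<Sum>k\<in>{1..<m}. cnj z ^ k * f k z)"
      by (simp add: f_def)
    also have "(\<Sum>k\<in>{1..<m}. cnj z ^ k * f k z)
        = - (\<Sum>k\<in>{1..<m}. of_real (M k) * cnj z ^ k * (z ^ p k / fact (p k)))"
      unfolding sum_negf[symmetric] by (intro sum.cong) (auto simp: f_def)
    finally show ?thesis by (simp add: extremal_G_def f0_def K_def)
  qed
  have poly: "polyanalytic_with m f (extremal_G m p M) (ball 0 1)"
    using hol sum by (simp add: polyanalytic_with_def)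
  have dk: "(deriv ^^ j) (f k) = (\<lambda>z. - of_real (M k) * z ^ (p k - j) / fact (p k - j))"
    if "k \<in> {1..<m}" "j \<le> p k" for k j
    using deriv_funpow_monomial[OF that(2), of "- of_real (M k)"] that(1) by (simp add: f_def)
  have v: "(deriv ^^ j) (f k) 0 = 0" if "k \<in> {1..<m}" "j < p k" for k j
    using dk[of k j] that by simp
  have b: "norm ((deriv ^^ p k) (f k) z) \<le> M k" if "k \<in> {1..<m}" for k z
    using dk[OF that order_refl] M[OF that] by simp
  have "f k 0 = 0" if "k \<in> {1..<m}" for k
    using v[OF that, of 0] p[OF that] by simp
  then have "wirtinger_z (extremal_G m p M) 0 = deriv (f 0) 0"
    by (rule wirtinger_z_polyanalytic_at_0[OF poly m])
  also have "\<dots> = 1" using d0[of 0] K by simp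
  finally have W: "wirtinger_z (extremal_G m p M) 0 = 1" .
  have "landau_hyps m p M f (extremal_G m p M)"
    unfolding landau_hyps_def
    using poly W v b d0 bd0 by (auto simp: f_def f0_def K_def)
  then show ?thesis by blast
qed

text \<open>On the real axis conjugation is trivial and the argument of the logarithm is positive,
  so sharpness reduces to the real function R.\<close>

lemma extremal_G_of_real:
  assumes "M 0 > 1" "x \<le> 1"
  shows "extremal_G m p M (of_real x) = of_real (schlicht_radius m p M x)"
proof -
  have "1 - of_real x / of_real (M 0) = (of_real (1 - x / M 0) :: complex)" by simp
  moreover have "1 - x / M 0 > 0" using assms by simp
  ultimately have "Ln (1 - of_real x / of_real (M 0)) = of_real (ln (1 - x / M 0))"
    by (simp only: Ln_of_real)
  then show ?thesis
    by (simp add: extremal_G_def schlicht_radius_def power_add mult_ac)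
qed

text \<open>Injectivity would pass to R on [0,b] with b beyond the root, and a continuous injective
  real function is strictly monotone there; but R rises up to the root and falls after it.\<close>

lemma extremal_G_not_inj_on:
  assumes M0: "M 0 > 1" and M: "\<And>k. k \<in> {1..<m} \<Longrightarrow> M k \<ge> 0"
    and root: "is_landau_root m p M r\<^sub>0" and r: "r\<^sub>0 < r" "r \<le> 1"
  shows "\<not> inj_on (extremal_G m p M) (ball 0 r)"
proof
  assume inj: "inj_on (extremal_G m p M) (ball 0 r)"
  let ?R = "schlicht_radius m p M"
  have r0: "0 < r\<^sub>0" "r\<^sub>0 < 1" using root by (auto simp: is_landau_root_iff)
  \<comment> \<open>A point strictly between, so that [0,b] lies in the open disk of radius
    \<open>r\<close> and passes the root.\<close>
  define b where "b = (r\<^sub>0 + r) / 2"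
  have b: "r\<^sub>0 < b" "b < r" using r by (auto simp: b_def)
  have "inj_on ?R {0..b}"
  proof (rule inj_onI)
    fix x y assume "x \<in> {0..b}" "y \<in> {0..b}" "?R x = ?R y"
    then have "extremal_G m p M (of_real x) = extremal_G m p M (of_real y)"
      and "(of_real x :: complex) \<in> ball 0 r" "(of_real y :: complex) \<in> ball 0 r"
      using extremal_G_of_real[where M = M, OF M0, of _ m p] b r by auto
    then have "(of_real x :: complex) = of_real y"
      by (rule inj_onD[OF inj])
    then show "x = y" by simp
  qed
  moreover have "continuous_on {0..b} ?R" using continuous_on_schlicht_radius[of M b 0] M0 b r by auto
  ultimately have "(?R 0 < ?R r\<^sub>0 \<and> ?R r\<^sub>0 < ?R b) \<or> (?R b < ?R r\<^sub>0 \<and> ?R r\<^sub>0 < ?R 0)"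
    using r0 b by (intro continuous_inj_imp_mono) auto
  moreover have "?R 0 < ?R r\<^sub>0"
  proof (rule DERIV_pos_imp_increasing_open[where f = ?R])
    show "\<exists>y. DERIV ?R x :> y \<and> y > 0" if "0 < x" "x < r\<^sub>0" for x
      using schlicht_radius_has_real_derivative[of M x m p] landau_fun_pos[of M m p r\<^sub>0 x] that r0 M0 M root
      by (auto intro!: exI[of _ "landau_fun m p M x"])
  qed (use r0 continuous_on_schlicht_radius M0 in auto)
  moreover have "?R b < ?R r\<^sub>0"
  proof (rule DERIV_neg_imp_decreasing_open[where f = ?R])
    show "\<exists>y. DERIV ?R x :> y \<and> y < 0" if "r\<^sub>0 < x" "x < b" for x
      using schlicht_radius_has_real_derivative[of M x m p] landau_fun_neg[of M m p r\<^sub>0 x] that b r M0 M root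
      by (auto intro!: exI[of _ "landau_fun m p M x"])
  qed (use r b continuous_on_schlicht_radius M0 in auto)
  ultimately show False by linarith
qed

theorem theorem3p1:
  fixes m :: nat and p :: "nat \<Rightarrow> nat" and M :: "nat \<Rightarrow> real"
  assumes "m \<ge> 1"
    and "\<forall>k\<in>{1..<m}. p k \<ge> 1"
    and "\<forall>k\<in>{1..<m}. M k \<ge> 0"
    and "M 0 > 0"
  shows
    "(\<forall>f F. landau_hyps m p M f F \<longrightarrow>
        M 0 > 1 \<and>
        (\<exists>!r. is_landau_root m p M r) \<and>
        (\<forall>r\<^sub>0. is_landau_root m p M r\<^sub>0 \<longrightarrow>
           inj_on F (ball 0 r\<^sub>0) \<and>
           schlicht_disk F (ball 0 r\<^sub>0) 0 (schlicht_radius m p M r\<^sub>0)))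
     \<and>
     (M 0 > 1 \<longrightarrow>
        (\<exists>f. landau_hyps m p M f (extremal_G m p M)) \<and>
        (\<exists>!r. is_landau_root m p M r) \<and>
        (\<forall>r\<^sub>0. is_landau_root m p M r\<^sub>0 \<longrightarrow>
           (\<forall>r\<in>{r\<^sub>0<..1}. \<not> inj_on (extremal_G m p M) (ball 0 r)) \<and>
           (\<forall>\<rho>>schlicht_radius m p M r\<^sub>0.
              \<not> ball 0 \<rho> \<subseteq> extremal_G m p M ` ball 0 r\<^sub>0)))"
proof -
  have p: "p k \<ge> 1" and M: "M k \<ge> 0" if "k \<in> {1..<m}" for k
    using assms(2,3) that by auto
  note m = assms(1)
  have "inj_on F (ball 0 r) \<and> schlicht_disk F (ball 0 r) 0 (schlicht_radius m p M r)"
    if hyps: "landau_hyps m p M f F" and root: "is_landau_root m p M r" for f F r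
  proof -
    have M0: "M 0 > 1" using landau_hyps_imp(1)[OF hyps m p] .
    have r: "0 < r" "r < 1" using root by (auto simp: is_landau_root_iff)
    have inj: "inj_on F (ball 0 r)"
      using landau_inj_on_cball[where p = p and M = M, OF hyps m p M root] by (rule inj_on_subset) auto
    have "continuous_on (ball 0 1) F"
      using hyps by (intro polyanalytic_with_continuous_on) (auto simp: landau_hyps_def)
    then have cont: "continuous_on (cball 0 r) F"
      by (rule continuous_on_subset) (use r in auto)
    have R: "schlicht_radius m p M r > 0" using schlicht_radius_pos[where M = M and p = p, OF M0 M p root] .
    have "ball 0 (schlicht_radius m p M r) \<subseteq> F ` ball 0 r"
    proof (rule ball_subset_image_of_sphere_norm_ge[OF cont inj _ r(1) R])
      show "F 0 = 0" using landau_hyps_imp(3)[OF hyps m p] .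
      show "schlicht_radius m p M r \<le> norm (F z)" if "z \<in> sphere 0 r" for z
        using landau_norm_ge[OF hyps m p, of z] that r by auto
    qed
    moreover have "continuous_on (ball 0 r) F" using cont by (rule continuous_on_subset) auto
    ultimately show ?thesis using inj R by (auto intro: schlicht_diskI)
  qed
  moreover have "M 0 > 1" if "landau_hyps m p M f F" for f F
    using landau_hyps_imp(1)[OF that m p] .
  moreover have "\<exists>!r. is_landau_root m p M r" if "M 0 > 1"
    using ex1_landau_root[where M = M and p = p, OF that M p] .
  moreover have "\<exists>f. landau_hyps m p M f (extremal_G m p M)" if "M 0 > 1"
    using extremal_G_landau_hyps[where M = M and p = p, OF that m M p] .
  moreover have "\<not> inj_on (extremal_G m p M) (ball 0 r)"
    if "M 0 > 1" "is_landau_root m p M r\<^sub>0" "r \<in> {r\<^sub>0<..1}" for r r\<^sub>0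
    using extremal_G_not_inj_on[where M = M, OF that(1) M that(2)] that(3) by auto
  moreover have "\<not> ball 0 \<rho> \<subseteq> extremal_G m p M ` ball 0 r\<^sub>0"
    if M0: "M 0 > 1" and root: "is_landau_root m p M r\<^sub>0" and \<rho>: "schlicht_radius m p M r\<^sub>0 < \<rho>"
    for \<rho> r\<^sub>0
  proof
    let ?R = "schlicht_radius m p M r\<^sub>0"
    assume sub: "ball 0 \<rho> \<subseteq> extremal_G m p M ` ball 0 r\<^sub>0"
    have r0: "0 < r\<^sub>0" "r\<^sub>0 < 1" using root by (auto simp: is_landau_root_iff)
    obtain f where hyps: "landau_hyps m p M f (extremal_G m p M)"
      using extremal_G_landau_hyps[where M = M and p = p, OF M0 m M p] by blast
    have "?R > 0" using schlicht_radius_pos[where M = M and p = p, OF M0 M p root] .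
    \<comment> \<open>The value r_1 is already taken at the boundary point \<open>r\<^sub>0\<close>,
      so by injectivity on the closed disk it has no preimage in the open disk.\<close>
    then have "of_real ?R \<in> ball (0::complex) \<rho>" using \<rho> by simp
    then obtain z where z: "z \<in> ball 0 r\<^sub>0" "extremal_G m p M z = of_real ?R" using sub by (metis imageE subsetD)
    have "extremal_G m p M z = extremal_G m p M (of_real r\<^sub>0)"
      using z(2) extremal_G_of_real[where M = M, OF M0, of r\<^sub>0 m p] r0 by simp
    moreover have "z \<in> cball 0 r\<^sub>0" "of_real r\<^sub>0 \<in> cball (0::complex) r\<^sub>0"
      using z(1) r0 by auto
    moreover have "inj_on (extremal_G m p M) (cball 0 r\<^sub>0)"
      using landau_inj_on_cball[where p = p and M = M, OF hyps m p M root] .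
    ultimately have "z = of_real r\<^sub>0" by (meson inj_onD)
    then show False using z r0 by simp
  qed
  ultimately show ?thesis by blast
qed

end
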